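(* Let $\{\widetilde Q_n\}_{n\ge0}$ be the monic version of any one of the following three sequences of polynomials, and let $\lambda_1$ be their first eigenvalue with respect to the associated second order differential operator. (1) (Inverse Gaussian) $\widetilde H_n(x)=(-1)^ne^{-x^2}\frac{d^n}{dx^n}e^{x^2}$, $x\in\mathbb{R}$, $n\ge0$, with associated operator $\widetilde{\mathcal O}=\frac{d^2}{dx^2}+2x\frac{d}{dx}$. (2) (Inverse Laguerre) for fixed $\alpha>-1$, $\widetilde L_n^\alpha(x)=\frac{e^{-x}x^\alpha}{n!}\frac{d^n}{dx^n}(e^xx^{n-\alpha})$, $x\in(0,\infty)$, $n\ge0$, with associated operator $\widetilde{\mathcal L}_\alpha=x\frac{d^2}{dx^2}+(-\alpha+1+x)\frac{d}{dx}$. (3) (Inverse Jacobi) for fixed $\alpha,\beta>-1$, $\widetilde P_n^{\alpha,\beta}(x)=\frac{(-1)^n}{2^nn!}(1-x)^\alpha(1+x)^\beta\frac{d^n}{dx^n}\big((1-x)^{-\alpha+n}(1+x)^{-\beta+n}\big)$, $x\in(-1,1)$, $n\ge0$, with associated operator $\widetilde{\mathcal G}_{\alpha,\beta}=(1-x^2)\frac{d^2}{dx^2}+\big((\alpha-\beta)+(\alpha+\beta-2)x\big)\frac{d}{dx}$. Then, for each case, there is a unique moment functional $\mathcal{L}$ such that $$\mathcal{L}[1]=\lambda_1,\qquad \mathcal{L}[\widetilde Q_m(x)\widetilde Q_n(x)]=0,\qquad \mathcal{L}[\widetilde Q_n^2(x)]\neq0,\qquad\text{for } m,n\ge0,\ m\ne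 n.$$
   Context: A moment functional is a linear functional $\mathcal{L}$ on the vector space of polynomials in $x$. The monic version of a sequence of polynomials is obtained by dividing each polynomial by its leading coefficient. The polynomials are eigenfunctions of the associated operators: $\widetilde{\mathcal O}\widetilde H_n=2n\widetilde H_n$, $\widetilde{\mathcal L}_\alpha\widetilde L_n^\alpha=n\widetilde L_n^\alpha$, and $\widetilde{\mathcal G}_{\alpha,\beta}\widetilde P_n^{\alpha,\beta}=-n(n-\alpha-\beta+1)\widetilde P_n^{\alpha,\beta}$.
   Formalization: The formal theorem excludes α∈{1,2,…} in (2), and α∈{1,2,…}, β∈{1,2,…} or α+β∈{2,3,…} in (3); the claim fails at exactly these parameters (e.g. in (2) with α=1, orthogonality forces L[Q_1^2]=0). *)

theory Defs
  imports "HOL-Analysis.Analysis" "HOL-Computational_Algebra.Polynomial"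
begin

(* The Rodrigues-type formulas below describe functions on an open interval I; the associated
   polynomial is the one that agrees with the function on I.  It is unique because I is infinite. *)
definition poly_on :: "real set \<Rightarrow> (real \<Rightarrow> real) \<Rightarrow> real poly" where
  "poly_on I f = (THE p. \<forall>x\<in>I. poly p x = f x)"

definition monic_version :: "(nat \<Rightarrow> real poly) \<Rightarrow> nat \<Rightarrow> real poly" where
  "monic_version P n = smult (inverse (lead_coeff (P n))) (P n)"

definition moment_functional :: "(real poly \<Rightarrow> real) \<Rightarrow> bool" where
  "moment_functional L \<longleftrightarrow> Vector_Spaces.linear smult (*) L"

(* The n-th eigenvalue of the operator D on I, in the indexing where Q n is the eigenfunction.
   It is well defined whenever Q n is a nonzero polynomial that is an eigenfunction of D on I. *)
definition eigenvalue ::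
    "real set \<Rightarrow> ((real \<Rightarrow> real) \<Rightarrow> real \<Rightarrow> real) \<Rightarrow> (nat \<Rightarrow> real poly) \<Rightarrow> nat \<Rightarrow> real" where
  "eigenvalue I D Q n = (THE l. \<forall>x\<in>I. D (poly (Q n)) x = l * poly (Q n) x)"

definition inv_hermite :: "nat \<Rightarrow> real poly" where
  "inv_hermite n = poly_on UNIV
     (\<lambda>x. (-1) ^ n * exp (- (x ^ 2)) * (deriv ^^ n) (\<lambda>t. exp (t ^ 2)) x)"

definition inv_hermite_op :: "(real \<Rightarrow> real) \<Rightarrow> real \<Rightarrow> real" where
  "inv_hermite_op f x = (deriv ^^ 2) f x + 2 * x * deriv f x"

definition inv_laguerre :: "real \<Rightarrow> nat \<Rightarrow> real poly" where
  "inv_laguerre \<alpha> n = poly_on {0<..}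
     (\<lambda>x. exp (- x) * x powr \<alpha> / fact n * (deriv ^^ n) (\<lambda>t. exp t * t powr (real n - \<alpha>)) x)"

definition inv_laguerre_op :: "real \<Rightarrow> (real \<Rightarrow> real) \<Rightarrow> real \<Rightarrow> real" where
  "inv_laguerre_op \<alpha> f x = x * (deriv ^^ 2) f x + (- \<alpha> + 1 + x) * deriv f x"

definition inv_jacobi :: "real \<Rightarrow> real \<Rightarrow> nat \<Rightarrow> real poly" where
  "inv_jacobi \<alpha> \<beta> n = poly_on {-1<..<1}
     (\<lambda>x. (-1) ^ n / (2 ^ n * fact n) * (1 - x) powr \<alpha> * (1 + x) powr \<beta> *
        (deriv ^^ n) (\<lambda>t. (1 - t) powr (- \<alpha> + real n) * (1 + t) powr (- \<beta> + real n)) x)"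

definition inv_jacobi_op :: "real \<Rightarrow> real \<Rightarrow> (real \<Rightarrow> real) \<Rightarrow> real \<Rightarrow> real" where
  "inv_jacobi_op \<alpha> \<beta> f x =
     (1 - x ^ 2) * (deriv ^^ 2) f x + ((\<alpha> - \<beta>) + (\<alpha> + \<beta> - 2) * x) * deriv f x"

end

theory Submission
  imports Defs
begin

text \<open>
  All three families are instances of one construction. Let \<open>\<phi>\<close> be a polynomial of degree at most
  two, \<open>\<psi>\<close> one of degree at most one, and let \<open>w\<close>, without zeros, satisfy the Pearson equation
  \<open>(\<phi> w)' = \<psi> w\<close> on an interval. For a polynomial \<open>p\<close>, differentiating \<open>\<phi>^(k+1) w p\<close> gives
  \<open>\<phi>^k w (T\<^sub>k p)\<close>, where \<open>T\<^sub>k p = \<phi> p' + (\<psi> + k \<phi>') p\<close>. Hence the Rodrigues expression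
  \<open>w^(-1) (\<phi>^n w)^(n)\<close> is the polynomial \<open>R\<^sub>n = T\<^sub>0 T\<^sub>1 \<dots> T\<^sub>(n-1) 1\<close>, and it has degree \<open>n\<close> as long
  as no \<open>b\<^sub>1 + k a\<^sub>2\<close> with \<open>k \<ge> 0\<close> vanishes, where \<open>a\<^sub>2\<close> is the coefficient of \<open>x^2\<close> in \<open>\<phi>\<close> and
  \<open>b\<^sub>1\<close> that of \<open>x\<close> in \<open>\<psi>\<close>.

  The weights \<open>exp (x^2)\<close>, \<open>exp x x^(-\<alpha>)\<close> and \<open>(1-x)^(-\<alpha>) (1+x)^(-\<beta>)\<close> need not be integrable
  against polynomials, so in general the functional is not an integral against \<open>w\<close>. What integration would
  provide is only the relation \<open>L (T\<^sub>0 p) = 0\<close> for all \<open>p\<close>, and this can be imposed algebraically: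
  tested on monomials it is a recurrence for the moments of \<open>L\<close>, which the condition on
  \<open>b\<^sub>1 + k a\<^sub>2\<close> makes solvable for any prescribed \<open>L 1\<close> (\<open>pearson_functional_exists\<close>).

  The relation permits formal integration by parts, and \<open>n\<close> such steps yield
  \<open>L (q R\<^sub>n) = (-1)^n L (\<phi>^n q^(n))\<close> (\<open>functional_mult_rodrigues\<close>). This is zero when
  \<open>degree q < n\<close>, which is orthogonality, and it is a nonzero multiple of \<open>L (\<phi>^n)\<close> when
  \<open>degree q = n\<close>. Finally \<open>L (\<phi>^(n+1))\<close> is a multiple of \<open>L (\<phi>^n)\<close>, with a factor that vanishes
  only if \<open>\<phi>\<close> vanishes at the root of \<open>\<psi> + n \<phi>'\<close> (\<open>functional_phi_power_Suc\<close>). In the three cases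
  the excluded parameters are exactly those where one of the two nonvanishing conditions fails.

  The first eigenvalue is \<open>b\<^sub>1\<close>, because \<open>R\<^sub>1 = \<psi>\<close>; it is nonzero. Uniqueness holds because the
  conditions fix \<open>L\<close> on the basis formed by the \<open>Q\<^sub>n\<close>: orthogonality to \<open>Q\<^sub>0 = 1\<close> forces
  \<open>L Q\<^sub>n = 0\<close> for \<open>n > 0\<close>.
\<close>

section \<open>Moment functionals\<close>

lemma moment_functional_iff:
  "moment_functional L \<longleftrightarrow>
     (\<forall>p q. L (p + q) = L p + L q) \<and> (\<forall>c p. L (smult c p) = c * L p)"
proof -
  have 1: "vector_space (smult :: real \<Rightarrow> real poly \<Rightarrow> real poly)"
    by unfold_locales (auto simp: smult_add_right smult_add_left)
  have 2: "vector_space ((*) :: real \<Rightarrow> real \<Rightarrow> real)"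
    by unfold_locales (auto simp: algebra_simps)
  show ?thesis
    unfolding moment_functional_def Vector_Spaces.linear_iff using 1 2 by blast
qed

lemma
  assumes "moment_functional L"
  shows moment_functional_add: "L (p + q) = L p + L q"
    and moment_functional_smult: "L (smult c p) = c * L p"
    and moment_functional_zero: "L 0 = 0"
    and moment_functional_minus: "L (- p) = - L p"
    and moment_functional_diff: "L (p - q) = L p - L q"
proof -
  show add: "L (p + q) = L p + L q" for p q
    using assms by (auto simp: moment_functional_iff)
  show sm: "L (smult c p) = c * L p" for c p
    using assms by (auto simp: moment_functional_iff)
  show "L 0 = 0" using sm[of 0 0] by simp
  show minus: "L (- p) = - L p" for p using sm[of "-1" p] by simp
  show "L (p - q) = L p - L q" using add[of p "- q"] minus[of q] by simp
qed

text \<open>A sequence with one polynomial of each degree spans all polynomials, by elimination of leading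
  terms; so a functional is determined by its values on such a sequence.\<close>

lemma moment_functional_eq_zero:
  assumes L: "moment_functional L"
    and deg: "\<And>k. degree (q k) \<le> k" and lc: "\<And>k. coeff (q k) k \<noteq> 0"
    and zero: "\<And>k. L (q k) = 0"
  shows "L p = 0"
proof -
  have "(\<forall>i\<ge>n. coeff p i = 0) \<Longrightarrow> L p = 0" for n p
  proof (induction n arbitrary: p)
    case 0
    then have "p = 0" by (simp add: poly_eq_iff)
    then show ?case by (simp add: moment_functional_zero[OF L])
  next
    case (Suc n)
    define r where "r = p - smult (coeff p n / coeff (q n) n) (q n)"
    have "coeff r i = 0" if "i \<ge> n" for i
    proof (cases "i = n")
      case True
      then show ?thesis using lc[of n] by (simp add: r_def)
    next
      case False
      then have "i \<ge> Suc n" using that by simp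
      moreover have "coeff (q n) i = 0"
        using deg[of n] \<open>i \<ge> Suc n\<close> by (intro coeff_eq_0) simp
      ultimately show ?thesis using Suc.prems by (simp add: r_def)
    qed
    then have "L r = 0" by (intro Suc.IH) simp
    then show ?case
      by (simp add: r_def moment_functional_diff[OF L] moment_functional_smult[OF L] zero)
  qed
  from this[of "Suc (degree p)" p] show ?thesis by (simp add: coeff_eq_0)
qed

definition functional_of_moments :: "(nat \<Rightarrow> real) \<Rightarrow> real poly \<Rightarrow> real" where
  "functional_of_moments \<mu> p = (\<Sum>i\<le>degree p. coeff p i * \<mu> i)"

lemma functional_of_moments_bound:
  assumes "degree p \<le> N"
  shows "functional_of_moments \<mu> p = (\<Sum>i\<le>N. coeff p i * \<mu> i)"
  unfolding functional_of_moments_def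
  by (rule sum.mono_neutral_left) (use assms in \<open>auto simp: coeff_eq_0\<close>)

lemma moment_functional_of_moments: "moment_functional (functional_of_moments \<mu>)"
  unfolding moment_functional_iff
proof (intro conjI allI)
  fix p q :: "real poly"
  let ?N = "max (degree p) (degree q)"
  have "degree (p + q) \<le> ?N" by (rule degree_add_le_max)
  then show "functional_of_moments \<mu> (p + q) = functional_of_moments \<mu> p + functional_of_moments \<mu> q"
    by (simp add: functional_of_moments_bound[of _ ?N] algebra_simps sum.distrib)
next
  fix c :: real and p :: "real poly"
  show "functional_of_moments \<mu> (smult c p) = c * functional_of_moments \<mu> p"
    by (simp add: functional_of_moments_bound[of _ "degree p"] sum_distrib_left algebra_simps)
qed

lemma functional_of_moments_monom: "functional_of_moments \<mu> (monom c k) = c * \<mu> k"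
  by (simp add: functional_of_moments_bound[of _ k] degree_monom_le if_distrib[of "\<lambda>x. x * _"] cong: if_cong)

section \<open>Pearson pairs\<close>

text \<open>The two assumptions exclude degenerate pairs \<open>\<phi> = a\<^sub>0 + a\<^sub>1 x + a\<^sub>2 x^2\<close>, \<open>\<psi> = b\<^sub>0 + b\<^sub>1 x\<close>.
  The first one controls leading coefficients. The second one says that \<open>\<phi>\<close> and \<open>\<psi> + n \<phi>'\<close> have
  no common root; without it some orthogonal polynomial would have norm zero.\<close>

locale pearson_pair =
  fixes a\<^sub>0 a\<^sub>1 a\<^sub>2 b\<^sub>0 b\<^sub>1 :: real
  assumes nondegenerate: "b\<^sub>1 + real k * a\<^sub>2 \<noteq> 0"
    and no_common_root:
      "b\<^sub>0 + b\<^sub>1 * x + real n * (a\<^sub>1 + 2 * a\<^sub>2 * x) = 0 \<Longrightarrow> a\<^sub>0 + a\<^sub>1 * x + a\<^sub>2 * x\<^sup>2 \<noteq> 0"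
begin

definition \<phi> :: "real poly" where "\<phi> = [:a\<^sub>0, a\<^sub>1, a\<^sub>2:]"
definition \<psi> :: "real poly" where "\<psi> = [:b\<^sub>0, b\<^sub>1:]"

text \<open>For a weight \<open>w\<close> with \<open>(\<phi> w)' = \<psi> w\<close>, this is the operator with
  \<open>(\<phi>^(k+1) w p)' = \<phi>^k w T k p\<close>.\<close>

definition T :: "nat \<Rightarrow> real poly \<Rightarrow> real poly" where
  "T k p = \<phi> * pderiv p + (\<psi> + of_nat k * pderiv \<phi>) * p"

text \<open>The \<open>j\<close>-th derivative of \<open>\<phi>^n w\<close> is \<open>\<phi>^(n-j) w\<close> times the polynomial \<open>rodrigues n j\<close>.\<close>

fun rodrigues :: "nat \<Rightarrow> nat \<Rightarrow> real poly" where
  "rodrigues n 0 = 1"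
| "rodrigues n (Suc j) = T (n - Suc j) (rodrigues n j)"

lemma T_0_power_mult: "T 0 (\<phi> ^ k * r) = \<phi> ^ k * T k r"
proof (cases k)
  case 0
  then show ?thesis by (simp add: T_def)
next
  case (Suc m)
  then show ?thesis
    by (simp add: T_def pderiv_mult pderiv_power_Suc of_nat_poly algebra_simps del: of_nat_Suc power_Suc)
       (simp add: algebra_simps)
qed

lemma T_mult: "T k (q * p) = q * T k p + \<phi> * pderiv q * p"
  by (simp add: T_def pderiv_mult algebra_simps)

lemma T_eq_pCons:
  "T k p = [:a\<^sub>0, a\<^sub>1, a\<^sub>2:] * pderiv p + [:b\<^sub>0 + real k * a\<^sub>1, b\<^sub>1 + 2 * real k * a\<^sub>2:] * p"
  by (simp add: T_def \<phi>_def \<psi>_def pderiv_pCons of_nat_poly mult_ac)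

lemma coeff_T_Suc:
  "coeff (T k p) (Suc i) = real (Suc (Suc i)) * a\<^sub>0 * coeff p (Suc (Suc i))
     + (b\<^sub>0 + real (Suc i + k) * a\<^sub>1) * coeff p (Suc i) + (b\<^sub>1 + real (i + 2 * k) * a\<^sub>2) * coeff p i"
  unfolding T_eq_pCons by (cases i) (simp_all add: coeff_pCons coeff_pderiv algebra_simps)

lemma degree_T_le:
  assumes "degree p \<le> m"
  shows "degree (T k p) \<le> Suc m"
proof (rule degree_le, intro allI impI)
  fix i assume "Suc m < i"
  then obtain j where "i = Suc j" "m < j" by (cases i) auto
  then show "coeff (T k p) i = 0" using assms by (simp add: coeff_T_Suc coeff_eq_0)
qed

lemma coeff_T_top:
  assumes "degree p \<le> m"
  shows "coeff (T k p) (Suc m) = (b\<^sub>1 + real (m + 2 * k) * a\<^sub>2) * coeff p m"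
  using assms by (simp add: coeff_T_Suc coeff_eq_0)

lemma rodrigues_degree: "degree (rodrigues n j) \<le> j" "coeff (rodrigues n j) j \<noteq> 0"
proof -
  have "degree (rodrigues n j) \<le> j \<and> coeff (rodrigues n j) j \<noteq> 0"
  proof (induction j)
    case (Suc j)
    then show ?case
      using nondegenerate[of "j + 2 * (n - Suc j)"] by (auto simp: degree_T_le coeff_T_top)
  qed simp
  then show "degree (rodrigues n j) \<le> j" "coeff (rodrigues n j) j \<noteq> 0" by auto
qed

section \<open>The functional of a Pearson pair\<close>

text \<open>The recurrence is \<open>L (T 0 (x^k)) = 0\<close> solved for the moment of \<open>x^(k+1)\<close>. For \<open>k = 0\<close> the
  truncated index \<open>k - 1\<close> is harmless, since its coefficient is zero.\<close>

fun pearson_moment :: "real \<Rightarrow> nat \<Rightarrow> real" where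
  "pearson_moment c 0 = c"
| "pearson_moment c (Suc k) =
     - (real k * a\<^sub>0 * pearson_moment c (k - 1) + (b\<^sub>0 + real k * a\<^sub>1) * pearson_moment c k)
       / (b\<^sub>1 + real k * a\<^sub>2)"

lemma T_0_monom:
  "T 0 (monom 1 k) = monom (real k * a\<^sub>0) (k - 1) + monom (b\<^sub>0 + real k * a\<^sub>1) k
     + monom (b\<^sub>1 + real k * a\<^sub>2) (Suc k)"
proof (rule poly_eqI)
  fix i
  show "coeff (T 0 (monom 1 k)) i = coeff (monom (real k * a\<^sub>0) (k - 1) + monom (b\<^sub>0 + real k * a\<^sub>1) k
     + monom (b\<^sub>1 + real k * a\<^sub>2) (Suc k)) i"
    by (cases i; cases k) (auto simp: T_eq_pCons coeff_pderiv coeff_pCons algebra_simps split: nat.splits)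
qed

text \<open>By linearity the relation \<open>L (T 0 p) = 0\<close> need only be checked on monomials, where it is the
  recurrence for the moments.\<close>

lemma pearson_functional_exists:
  obtains L where "moment_functional L" "L 1 = c" "\<And>p. L (T 0 p) = 0"
proof
  let ?L = "functional_of_moments (pearson_moment c)"
  show L: "moment_functional ?L" by (rule moment_functional_of_moments)
  show "?L 1 = c" using functional_of_moments_monom[of _ 1 0] by (simp add: monom_0 one_pCons)
  have monom: "?L (T 0 (monom 1 k)) = 0" for k
    using nondegenerate[of k]
    by (simp add: T_0_monom moment_functional_add[OF L] functional_of_moments_monom)
  have "T 0 (p + q) = T 0 p + T 0 q" "T 0 (smult d p) = smult d (T 0 p)" for p q d
    by (simp_all add: T_def pderiv_add pderiv_smult algebra_simps smult_add_right)
  then have "moment_functional (\<lambda>p. ?L (T 0 p))"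
    by (simp add: moment_functional_iff moment_functional_add[OF L] moment_functional_smult[OF L])
  then show "?L (T 0 p) = 0" for p
    by (rule moment_functional_eq_zero[of _ "monom 1"]) (auto simp: degree_monom_le monom)
qed

context
  fixes L :: "real poly \<Rightarrow> real"
  assumes L: "moment_functional L" and pearson: "\<And>p. L (T 0 p) = 0"
begin

text \<open>Integration by parts without an integral: apply the Pearson relation to \<open>\<phi>^k q p\<close>. The power of
  \<open>\<phi>\<close> rises by one because \<open>L (\<phi>^k \<cdot>)\<close> is the functional of the pair \<open>\<phi>\<close>, \<open>\<psi> + k \<phi>'\<close>.\<close>

lemma functional_by_parts: "L (\<phi> ^ k * (q * T k p)) = - L (\<phi> ^ Suc k * (pderiv q * p))"
proof -
  have "T 0 (\<phi> ^ k * (q * p)) = \<phi> ^ k * (q * T k p) + \<phi> ^ Suc k * (pderiv q * p)"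
    unfolding T_0_power_mult unfolding T_mult by (simp add: algebra_simps)
  then show ?thesis
    using pearson[of "\<phi> ^ k * (q * p)"] moment_functional_add[OF L] by simp
qed

lemma functional_mult_rodrigues_aux:
  assumes "j \<le> n"
  shows "L (\<phi> ^ (n - j) * (q * rodrigues n j)) = (-1) ^ j * L (\<phi> ^ n * (pderiv ^^ j) q)"
  using assms
proof (induction j arbitrary: q)
  case (Suc j)
  have "Suc (n - Suc j) = n - j" using Suc.prems by simp
  then have "L (\<phi> ^ (n - Suc j) * (q * rodrigues n (Suc j)))
      = - L (\<phi> ^ (n - j) * (pderiv q * rodrigues n j))"
    using functional_by_parts[of "n - Suc j" q "rodrigues n j"] by simp
  also have "\<dots> = (-1) ^ Suc j * L (\<phi> ^ n * (pderiv ^^ Suc j) q)"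
    using Suc.IH[of "pderiv q"] Suc.prems by (simp add: funpow_swap1)
  finally show ?case .
qed simp

lemma functional_mult_rodrigues:
  "L (q * rodrigues n n) = (-1) ^ n * L (\<phi> ^ n * (pderiv ^^ n) q)"
  using functional_mult_rodrigues_aux[of n n q] by simp

text \<open>With \<open>d = b\<^sub>1 + 2 n a\<^sub>2\<close> and \<open>x\<^sub>0\<close> the root of \<open>\<psi> + n \<phi>' = d (x - x\<^sub>0)\<close>, integrating by parts
  against \<open>\<phi>^n\<close> shows that \<open>x - x\<^sub>0\<close> is annihilated and that \<open>(x - x\<^sub>0)^2\<close> has the value of
  \<open>-\<phi>/d\<close>. Inserting this in the Taylor expansion of \<open>\<phi>\<close> at \<open>x\<^sub>0\<close> gives the relation.\<close>

lemma functional_phi_power_Suc: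
  fixes n defines "d \<equiv> b\<^sub>1 + 2 * real n * a\<^sub>2"
  defines "x0 \<equiv> - (b\<^sub>0 + real n * a\<^sub>1) / d"
  shows "(d + a\<^sub>2) * L (\<phi> ^ Suc n) = d * poly \<phi> x0 * L (\<phi> ^ n)"
proof -
  have d: "d \<noteq> 0" using nondegenerate[of "2 * n"] by (simp add: d_def)
  have e: "b\<^sub>0 + real n * a\<^sub>1 = - d * x0" using d by (simp add: x0_def)
  define u where "u = [:- x0, 1:]"
  have T1: "T n 1 = smult d u"
    by (simp add: T_eq_pCons u_def d_def[symmetric] e mult.assoc[symmetric] d_def[symmetric])
  have "L (\<phi> ^ n * T n 1) = 0"
    using functional_by_parts[of n 1 1] by (simp add: moment_functional_zero[OF L])
  then have u1: "L (\<phi> ^ n * u) = 0"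
    using d by (simp add: T1 moment_functional_smult[OF L])
  have "L (\<phi> ^ n * (u * T n 1)) = - L (\<phi> ^ Suc n)"
    using functional_by_parts[of n u 1] by (simp add: u_def pderiv_pCons)
  then have u2: "d * L (\<phi> ^ n * (u * u)) = - L (\<phi> ^ Suc n)"
    by (simp add: T1 moment_functional_smult[OF L])
  have "\<phi> = [:poly \<phi> x0:] + smult (a\<^sub>1 + 2 * a\<^sub>2 * x0) u + smult a\<^sub>2 (u * u)"
    by (simp add: \<phi>_def u_def algebra_simps)
  then have "\<phi> ^ Suc n = smult (poly \<phi> x0) (\<phi> ^ n) + smult (a\<^sub>1 + 2 * a\<^sub>2 * x0) (\<phi> ^ n * u)
      + smult a\<^sub>2 (\<phi> ^ n * (u * u))"
    by (metis (no_types, lifting) distrib_left mult_smult_right mult.commute mult.right_neutral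
        power_Suc smult_one)
  then have "L (\<phi> ^ Suc n) = poly \<phi> x0 * L (\<phi> ^ n) + a\<^sub>2 * L (\<phi> ^ n * (u * u))"
    by (simp add: moment_functional_add[OF L] moment_functional_smult[OF L] u1)
  then have "d * L (\<phi> ^ Suc n) = d * poly \<phi> x0 * L (\<phi> ^ n) + a\<^sub>2 * (d * L (\<phi> ^ n * (u * u)))"
    by (simp add: algebra_simps)
  then show ?thesis unfolding u2 by (simp add: algebra_simps)
qed

lemma functional_phi_power_nonzero:
  assumes "L 1 \<noteq> 0"
  shows "L (\<phi> ^ n) \<noteq> 0"
proof (induction n)
  case (Suc n)
  define d where "d = b\<^sub>1 + 2 * real n * a\<^sub>2"
  define x0 where "x0 = - (b\<^sub>0 + real n * a\<^sub>1) / d"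
  have d: "d \<noteq> 0" using nondegenerate[of "2 * n"] by (simp add: d_def)
  have "d * x0 = - (b\<^sub>0 + real n * a\<^sub>1)" using d by (simp add: x0_def)
  then have "b\<^sub>0 + b\<^sub>1 * x0 + real n * (a\<^sub>1 + 2 * a\<^sub>2 * x0) = 0"
    by (simp add: d_def algebra_simps)
  then have "poly \<phi> x0 \<noteq> 0"
    using no_common_root by (fastforce simp: \<phi>_def power2_eq_square algebra_simps)
  then show ?case
    using functional_phi_power_Suc[of n] Suc.IH d unfolding d_def[symmetric] x0_def[symmetric]
    by auto
qed (simp add: assms)

lemma functional_rodrigues_orthogonal:
  assumes "m \<noteq> n"
  shows "L (rodrigues m m * rodrigues n n) = 0"
proof -
  have lt: "L (rodrigues m m * rodrigues n n) = 0" if "m < n" for m n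
  proof -
    have "coeff (rodrigues m m) (i + n) = 0" for i
      using rodrigues_degree(1)[of m m] that by (intro coeff_eq_0) simp
    then have "(pderiv ^^ n) (rodrigues m m) = 0"
      by (intro poly_eqI) (simp add: coeff_higher_pderiv)
    then show ?thesis by (simp add: functional_mult_rodrigues moment_functional_zero[OF L])
  qed
  show ?thesis using lt[of m n] lt[of n m] assms by (cases "m < n") (auto simp: mult.commute)
qed

lemma functional_rodrigues_square_nonzero:
  assumes "L 1 \<noteq> 0"
  shows "L ((rodrigues n n)\<^sup>2) \<noteq> 0"
proof -
  let ?c = "fact n * coeff (rodrigues n n) n"
  have "coeff ((pderiv ^^ n) (rodrigues n n)) i = coeff [:?c:] i" for i
  proof (cases i)
    case 0
    then show ?thesis by (simp add: coeff_higher_pderiv pochhammer_fact[symmetric])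
  next
    case (Suc k)
    then have "coeff (rodrigues n n) (i + n) = 0"
      using rodrigues_degree(1)[of n n] by (intro coeff_eq_0) simp
    then show ?thesis by (simp add: coeff_higher_pderiv Suc)
  qed
  then have "(pderiv ^^ n) (rodrigues n n) = [:?c:]" by (rule poly_eqI)
  then have "L ((rodrigues n n)\<^sup>2) = (-1) ^ n * (?c * L (\<phi> ^ n))"
    by (simp add: power2_eq_square functional_mult_rodrigues moment_functional_smult[OF L])
  then show ?thesis
    using rodrigues_degree(2)[of n n] functional_phi_power_nonzero[OF assms] by simp
qed

end

lemma monic_version_smult_rodrigues:
  assumes "P = (\<lambda>n. smult (c n) (rodrigues n n))" and "\<And>n. c n \<noteq> 0"
  shows "monic_version P n = smult (inverse (coeff (rodrigues n n) n)) (rodrigues n n)"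
proof -
  have "degree (rodrigues n n) = n"
    using rodrigues_degree[of n n] le_degree by (metis le_antisym)
  then show ?thesis using assms rodrigues_degree(2)[of n n] by (simp add: monic_version_def field_simps)
qed

theorem unique_orthogonalizing_functional:
  assumes P: "P = (\<lambda>n. smult (c n) (rodrigues n n))" "\<And>n. c n \<noteq> 0"
    and Q: "Q = monic_version P" and \<kappa>: "\<kappa> \<noteq> 0"
  shows "\<exists>!L. moment_functional L \<and> L 1 = \<kappa> \<and>
           (\<forall>m n. m \<noteq> n \<longrightarrow> L (Q m * Q n) = 0) \<and>
           (\<forall>n. L ((Q n)\<^sup>2) \<noteq> 0)"
proof -
  define s where "s n = inverse (coeff (rodrigues n n) n)" for n
  have Q_eq: "Q n = smult (s n) (rodrigues n n)" for n
    unfolding Q s_def by (rule monic_version_smult_rodrigues[OF P])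
  have s: "s n \<noteq> 0" for n using rodrigues_degree(2)[of n n] by (simp add: s_def)
  show ?thesis
  proof (rule ex_ex1I)
    obtain L where L: "moment_functional L" "L 1 = \<kappa>" "\<And>p. L (T 0 p) = 0"
      using pearson_functional_exists[of \<kappa>] by blast
    have "L (Q m * Q n) = 0" if "m \<noteq> n" for m n
      using functional_rodrigues_orthogonal[OF L(1,3) that]
      by (simp add: Q_eq moment_functional_smult[OF L(1)])
    moreover have "L ((Q n)\<^sup>2) \<noteq> 0" for n
      using functional_rodrigues_square_nonzero[OF L(1,3), of n] L(2) \<kappa> s[of n]
      by (simp add: Q_eq power2_eq_square moment_functional_smult[OF L(1)])
    ultimately show "\<exists>L. moment_functional L \<and> L 1 = \<kappa> \<and>
        (\<forall>m n. m \<noteq> n \<longrightarrow> L (Q m * Q n) = 0) \<and> (\<forall>n. L ((Q n)\<^sup>2) \<noteq> 0)"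
      using L(1,2) by blast
  next
    fix L M
    assume L: "moment_functional L \<and> L 1 = \<kappa> \<and>
        (\<forall>m n. m \<noteq> n \<longrightarrow> L (Q m * Q n) = 0) \<and> (\<forall>n. L ((Q n)\<^sup>2) \<noteq> 0)"
      and M: "moment_functional M \<and> M 1 = \<kappa> \<and>
        (\<forall>m n. m \<noteq> n \<longrightarrow> M (Q m * Q n) = 0) \<and> (\<forall>n. M ((Q n)\<^sup>2) \<noteq> 0)"
    have Q0: "Q 0 = 1" by (simp add: Q_eq s_def)
    have "L (Q n) = M (Q n)" for n
    proof (cases n)
      case 0
      then show ?thesis using L M by (simp add: Q0)
    next
      case (Suc k)
      then have "L (Q 0 * Q n) = 0" "M (Q 0 * Q n) = 0" using L M by blast+
      then show ?thesis by (simp add: Q0)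
    qed
    then have zero: "L (Q n) - M (Q n) = 0" for n by simp
    have diff: "moment_functional (\<lambda>p. L p - M p)"
      using L M by (simp add: moment_functional_iff algebra_simps)
    have "L p - M p = 0" for p
      by (rule moment_functional_eq_zero[OF diff _ _ zero])
         (use rodrigues_degree s in \<open>auto simp: Q_eq intro: order.trans[OF degree_smult_le]\<close>)
    then show "L = M" by (intro ext) simp
  qed
qed

end

section \<open>Rodrigues formulas\<close>

lemma poly_on_eq:
  assumes "open I" "I \<noteq> {}" and "\<And>x. x \<in> I \<Longrightarrow> f x = poly p x"
  shows "poly_on I f = p"
  unfolding poly_on_def
proof (rule the_equality)
  show "\<forall>x\<in>I. poly p x = f x" using assms(3) by simp
  fix q assume q: "\<forall>x\<in>I. poly q x = f x"
  show "q = p"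
  proof (rule ccontr)
    assume "q \<noteq> p"
    then have "finite {x. poly (q - p) x = 0}" by (intro poly_roots_finite) simp
    moreover have "I \<subseteq> {x. poly (q - p) x = 0}" using q assms(3) by auto
    ultimately show False
      using assms(1,2) finite_imp_not_open finite_subset by blast
  qed
qed

text \<open>The analytic input is the Pearson equation \<open>(\<phi> w)' = \<psi> w\<close> on an open set where \<open>w\<close> has no
  zeros.\<close>

locale pearson_weight = pearson_pair +
  fixes I :: "real set" and w :: "real \<Rightarrow> real"
  assumes open_I: "open I" and I_nonempty: "I \<noteq> {}"
    and w_nonzero: "x \<in> I \<Longrightarrow> w x \<noteq> 0"
    and pearson_equation:
      "x \<in> I \<Longrightarrow> ((\<lambda>t. poly \<phi> t * w t) has_real_derivative poly \<psi> x * w x) (at x)"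
begin

lemma deriv_power_phi_weight:
  assumes "x \<in> I"
  shows "((\<lambda>t. poly (\<phi> ^ Suc k * p) t * w t) has_real_derivative poly (\<phi> ^ k * T k p) x * w x) (at x)"
proof -
  let ?r = "\<phi> ^ k * p"
  have "((\<lambda>t. poly ?r t * (poly \<phi> t * w t)) has_real_derivative
      poly (pderiv ?r) x * (poly \<phi> x * w x) + poly \<psi> x * w x * poly ?r x) (at x)"
    by (rule DERIV_mult[OF poly_DERIV pearson_equation[OF assms]])
  moreover have "poly (pderiv ?r) x * (poly \<phi> x * w x) + poly \<psi> x * w x * poly ?r x
      = poly (T 0 ?r) x * w x"
    unfolding T_def by (simp add: algebra_simps)
  ultimately show ?thesis
    unfolding T_0_power_mult by (simp add: mult_ac)
qed

lemma higher_deriv_weight: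
  assumes f: "\<And>t. t \<in> I \<Longrightarrow> f t = poly \<phi> t ^ n * w t" and "x \<in> I"
  shows "(deriv ^^ n) f x = poly (rodrigues n n) x * w x"
proof -
  have "(deriv ^^ j) f x = poly (\<phi> ^ (n - j) * rodrigues n j) x * w x" if "j \<le> n" "x \<in> I" for j x
    using that
  proof (induction j arbitrary: x)
    case 0
    then show ?case by (simp add: f)
  next
    case (Suc j)
    have j: "n - j = Suc (n - Suc j)" using Suc.prems by simp
    have "eventually (\<lambda>t. t \<in> I) (nhds x)" 
      using open_I Suc.prems(2) by (rule eventually_nhds_in_open)
    then have "eventually (\<lambda>t. (deriv ^^ j) f t =
        poly (\<phi> ^ Suc (n - Suc j) * rodrigues n j) t * w t) (nhds x)"
      by eventually_elim (use Suc.IH Suc.prems in \<open>simp add: j\<close>)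
    then have "(deriv ^^ Suc j) f x
        = deriv (\<lambda>t. poly (\<phi> ^ Suc (n - Suc j) * rodrigues n j) t * w t) x"
      by (simp add: deriv_cong_ev)
    also have "\<dots> = poly (\<phi> ^ (n - Suc j) * T (n - Suc j) (rodrigues n j)) x * w x"
      by (rule DERIV_imp_deriv[OF deriv_power_phi_weight[OF Suc.prems(2)]])
    finally show ?case by simp
  qed
  from this[of n x] \<open>x \<in> I\<close> show ?thesis by simp
qed

lemma poly_on_rodrigues_formula:
  assumes f: "\<And>t. t \<in> I \<Longrightarrow> f t = poly \<phi> t ^ n * w t"
    and g: "\<And>x. x \<in> I \<Longrightarrow> g x = c / w x"
  shows "poly_on I (\<lambda>x. g x * (deriv ^^ n) f x) = smult c (rodrigues n n)"
  by (rule poly_on_eq[OF open_I I_nonempty])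
     (simp add: g higher_deriv_weight[OF f] w_nonzero)

text \<open>The first polynomial is \<open>\<psi>/b\<^sub>1\<close>, with derivative \<open>1\<close>, so the operator maps it to \<open>\<psi>\<close>.\<close>

lemma first_eigenvalue_eq:
  assumes P: "P = (\<lambda>n. smult (c n) (rodrigues n n))" "\<And>n. c n \<noteq> 0"
    and D: "\<And>f x. D f x = poly \<phi> x * (deriv ^^ 2) f x + poly \<psi> x * deriv f x"
  shows "eigenvalue I D (monic_version P) 1 = b\<^sub>1"
proof -
  have b\<^sub>1: "b\<^sub>1 \<noteq> 0" using nondegenerate[of 0] by simp
  let ?Q = "monic_version P 1"
  have Q: "?Q = smult (inverse b\<^sub>1) \<psi>"
    by (simp add: monic_version_smult_rodrigues[OF P] T_eq_pCons \<psi>_def)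
  have deriv_poly: "deriv (poly p) = poly (pderiv p)" for p :: "real poly"
    by (rule ext, rule DERIV_imp_deriv, rule poly_DERIV)
  have DQ: "D (poly ?Q) x = b\<^sub>1 * poly ?Q x" for x
    unfolding D Q using b\<^sub>1
    by (simp add: deriv_poly eval_nat_numeral \<psi>_def pderiv_pCons pderiv_smult field_simps)
  have "\<exists>x\<in>I. poly ?Q x \<noteq> 0"
  proof (rule ccontr)
    assume "\<not> ?thesis"
    then have "I \<subseteq> {x. poly ?Q x = 0}" by auto
    moreover have "finite {x. poly ?Q x = 0}"
      unfolding Q using b\<^sub>1 by (intro poly_roots_finite) (simp add: \<psi>_def)
    ultimately show False
      using open_I I_nonempty finite_imp_not_open finite_subset by blast
  qed
  then show ?thesis
    unfolding eigenvalue_def DQ by (intro the_equality) auto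
qed

text \<open>For such a family the first eigenvalue \<open>b\<^sub>1\<close> is an admissible value for \<open>L 1\<close>, being nonzero.\<close>

theorem unique_functional_for_weight:
  assumes P: "\<And>n. P n = poly_on I (\<lambda>x. g n x * (deriv ^^ n) (f n) x)"
    and f: "\<And>n t. t \<in> I \<Longrightarrow> f n t = poly \<phi> t ^ n * w t"
    and g: "\<And>n x. x \<in> I \<Longrightarrow> g n x = c n / w x" and c: "\<And>n. c n \<noteq> 0"
    and D: "\<And>f x. D f x = poly \<phi> x * (deriv ^^ 2) f x + poly \<psi> x * deriv f x"
    and Q: "Q = monic_version P" and \<kappa>: "\<kappa> = eigenvalue I D Q 1"
  shows "\<exists>!L. moment_functional L \<and> L 1 = \<kappa> \<and>
           (\<forall>m n. m \<noteq> n \<longrightarrow> L (Q m * Q n) = 0) \<and>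
           (\<forall>n. L ((Q n)\<^sup>2) \<noteq> 0)"
proof -
  have P': "P = (\<lambda>n. smult (c n) (rodrigues n n))"
    by (rule ext, subst P, rule poly_on_rodrigues_formula) (auto simp: f g)
  have "\<kappa> = b\<^sub>1" unfolding \<kappa> Q by (rule first_eigenvalue_eq[OF P' c D])
  then have "\<kappa> \<noteq> 0" using nondegenerate[of 0] by simp
  then show ?thesis by (rule unique_orthogonalizing_functional[OF P' c Q])
qed

end

section \<open>The three families\<close>

text \<open>Inverse Gaussian: \<open>\<phi> = 1\<close>, \<open>\<psi> = 2 x\<close>, and \<open>\<phi>\<close> has no roots at all.\<close>

lemma inv_hermite_pair: "pearson_pair 1 0 0 0 2"
  by unfold_locales auto

lemma inv_hermite_weight: "pearson_weight 1 0 0 0 2 UNIV (\<lambda>x. exp (x\<^sup>2))"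
proof -
  interpret pearson_pair 1 0 0 0 2 by (rule inv_hermite_pair)
  show ?thesis
    by unfold_locales
       (auto simp: \<phi>_def \<psi>_def intro!: derivative_eq_intros)
qed

theorem inv_hermite_unique_functional:
  assumes "Q = monic_version inv_hermite" "\<kappa> = eigenvalue UNIV inv_hermite_op Q 1"
  shows "\<exists>!L. moment_functional L \<and> L 1 = \<kappa> \<and>
           (\<forall>m n. m \<noteq> n \<longrightarrow> L (Q m * Q n) = 0) \<and>
           (\<forall>n. L ((Q n)\<^sup>2) \<noteq> 0)"
proof -
  interpret pearson_weight 1 0 0 0 2 UNIV "\<lambda>x. exp (x\<^sup>2)" by (rule inv_hermite_weight)
  show ?thesis
    by (rule unique_functional_for_weight[OF inv_hermite_def, where c = "\<lambda>n. (-1) ^ n"])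
       (use assms in \<open>auto simp: \<phi>_def \<psi>_def inv_hermite_op_def exp_minus field_simps\<close>)
qed

text \<open>Inverse Laguerre: \<open>\<phi> = x\<close>, \<open>\<psi> = 1 - \<alpha> + x\<close>, and the only root of \<open>\<phi>\<close> is a root of \<open>\<psi> + n \<phi>'\<close> just
  when \<open>\<alpha> = n + 1\<close>.\<close>

lemma inv_laguerre_pair:
  assumes "\<alpha> \<notin> real ` {1..}"
  shows "pearson_pair 0 1 0 (1 - \<alpha>) 1"
proof unfold_locales
  fix x :: real and n :: nat
  assume "1 - \<alpha> + 1 * x + real n * (1 + 2 * 0 * x) = 0"
  then have "\<alpha> = real (Suc n)" if "x = 0" using that by simp
  moreover have "real (Suc n) \<in> real ` {1..}" by (rule imageI) simp
  ultimately show "0 + 1 * x + 0 * x\<^sup>2 \<noteq> 0" using assms by auto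
qed simp

lemma inv_laguerre_weight:
  assumes "\<alpha> \<notin> real ` {1..}"
  shows "pearson_weight 0 1 0 (1 - \<alpha>) 1 {0<..} (\<lambda>x. exp x * x powr (- \<alpha>))"
proof -
  interpret pearson_pair 0 1 0 "1 - \<alpha>" 1 by (rule inv_laguerre_pair[OF assms])
  show ?thesis
  proof unfold_locales
    fix x :: real assume "x \<in> {0<..}"
    then have x: "x > 0" by simp
    have "x powr (- \<alpha>) = x powr (- \<alpha> - 1) * x"
      using x by (simp add: powr_diff)
    then show "((\<lambda>t. poly \<phi> t * (exp t * t powr (- \<alpha>))) has_real_derivative
        poly \<psi> x * (exp x * x powr (- \<alpha>))) (at x)"
      using x unfolding \<phi>_def \<psi>_def
      by (auto intro!: derivative_eq_intros simp: algebra_simps)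
  qed auto
qed

theorem inv_laguerre_unique_functional:
  assumes "\<alpha> \<notin> real ` {1..}"
    and "Q = monic_version (inv_laguerre \<alpha>)" "\<kappa> = eigenvalue {0<..} (inv_laguerre_op \<alpha>) Q 1"
  shows "\<exists>!L. moment_functional L \<and> L 1 = \<kappa> \<and>
           (\<forall>m n. m \<noteq> n \<longrightarrow> L (Q m * Q n) = 0) \<and>
           (\<forall>n. L ((Q n)\<^sup>2) \<noteq> 0)"
proof -
  interpret pearson_weight 0 1 0 "1 - \<alpha>" 1 "{0<..}" "\<lambda>x. exp x * x powr (- \<alpha>)"
    by (rule inv_laguerre_weight[OF assms(1)])
  show ?thesis
    by (rule unique_functional_for_weight[OF inv_laguerre_def, where c = "\<lambda>n. 1 / fact n"])
       (use assms in \<open>auto simp: \<phi>_def \<psi>_def inv_laguerre_op_def exp_minus powr_minus powr_diff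
          powr_realpow field_simps\<close>)
qed

text \<open>Inverse Jacobi: \<open>\<phi> = 1 - x^2\<close>, \<open>\<psi> = (\<alpha> - \<beta>) + (\<alpha> + \<beta> - 2) x\<close>. At the roots \<open>1\<close> and \<open>-1\<close> of \<open>\<phi>\<close>,
  \<open>\<psi> + n \<phi>'\<close> has the values \<open>2 (\<alpha> - n - 1)\<close> and \<open>-2 (\<beta> - n - 1)\<close>. The leading coefficients
  involve \<open>\<alpha> + \<beta> - 2 - k\<close>, which accounts for the exclusion of the sums \<open>\<alpha> + \<beta> = 2, 3, \<dots>\<close>.\<close>

lemma inv_jacobi_pair:
  assumes "\<alpha> \<notin> real ` {1..}" "\<beta> \<notin> real ` {1..}" "\<alpha> + \<beta> \<notin> real ` {2..}"
  shows "pearson_pair 1 0 (-1) (\<alpha> - \<beta>) (\<alpha> + \<beta> - 2)"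
proof unfold_locales
  fix k
  have "real (k + 2) \<in> real ` {2..}" by (rule imageI) simp
  then have "\<alpha> + \<beta> \<noteq> real (k + 2)" using assms(3) by metis
  then show "\<alpha> + \<beta> - 2 + real k * -1 \<noteq> 0" by simp
next
  fix x :: real and n :: nat
  assume *: "\<alpha> - \<beta> + (\<alpha> + \<beta> - 2) * x + real n * (0 + 2 * -1 * x) = 0"
  have "real (Suc n) \<in> real ` {1..}" by (rule imageI) simp
  then have ne: "\<alpha> \<noteq> real (Suc n)" "\<beta> \<noteq> real (Suc n)" using assms by metis+
  have "x \<noteq> 1" using * ne(1) by auto
  moreover have "x \<noteq> -1" using * ne(2) by auto
  ultimately have "x\<^sup>2 \<noteq> 1" by (simp add: power2_eq_1_iff)
  then show "1 + 0 * x + -1 * x\<^sup>2 \<noteq> 0" by simp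
qed

lemma inv_jacobi_weight:
  assumes "\<alpha> \<notin> real ` {1..}" "\<beta> \<notin> real ` {1..}" "\<alpha> + \<beta> \<notin> real ` {2..}"
  shows "pearson_weight 1 0 (-1) (\<alpha> - \<beta>) (\<alpha> + \<beta> - 2) {-1<..<1}
    (\<lambda>x. (1 - x) powr (- \<alpha>) * (1 + x) powr (- \<beta>))"
proof -
  interpret pearson_pair 1 0 "-1" "\<alpha> - \<beta>" "\<alpha> + \<beta> - 2" by (rule inv_jacobi_pair[OF assms])
  show ?thesis
  proof unfold_locales
    fix x :: real assume "x \<in> {-1<..<1}"
    then have x: "1 - x > 0" "1 + x > 0" by auto
    have *: "(1 - x) powr (- \<alpha>) = (1 - x) powr (- \<alpha> - 1) * (1 - x)"
      "(1 + x) powr (- \<beta>) = (1 + x) powr (- \<beta> - 1) * (1 + x)"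
      using x by (simp_all add: powr_diff)
    show "((\<lambda>t. poly \<phi> t * ((1 - t) powr (- \<alpha>) * (1 + t) powr (- \<beta>))) has_real_derivative
        poly \<psi> x * ((1 - x) powr (- \<alpha>) * (1 + x) powr (- \<beta>))) (at x)"
      using x unfolding \<phi>_def \<psi>_def
      by (auto intro!: derivative_eq_intros simp: *) (simp add: algebra_simps)
  qed auto
qed

theorem inv_jacobi_unique_functional:
  assumes "\<alpha> \<notin> real ` {1..}" "\<beta> \<notin> real ` {1..}" "\<alpha> + \<beta> \<notin> real ` {2..}"
    and "Q = monic_version (inv_jacobi \<alpha> \<beta>)"
    and "\<kappa> = eigenvalue {-1<..<1} (inv_jacobi_op \<alpha> \<beta>) Q 1"
  shows "\<exists>!L. moment_functional L \<and> L 1 = \<kappa> \<and>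
           (\<forall>m n. m \<noteq> n \<longrightarrow> L (Q m * Q n) = 0) \<and>
           (\<forall>n. L ((Q n)\<^sup>2) \<noteq> 0)"
proof -
  interpret pearson_weight 1 0 "-1" "\<alpha> - \<beta>" "\<alpha> + \<beta> - 2" "{-1<..<1}"
    "\<lambda>x. (1 - x) powr (- \<alpha>) * (1 + x) powr (- \<beta>)"
    by (rule inv_jacobi_weight[OF assms(1-3)])
  have \<phi>: "poly \<phi> t = (1 - t) * (1 + t)" for t by (simp add: \<phi>_def algebra_simps)
  show ?thesis
  proof (rule unique_functional_for_weight[OF inv_jacobi_def,
        where c = "\<lambda>n. (-1) ^ n / (2 ^ n * fact n)"])
    fix n :: nat and t :: real assume "t \<in> {-1<..<1}"
    then have t: "1 - t > 0" "1 + t > 0" by auto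
    show "(1 - t) powr (- \<alpha> + real n) * (1 + t) powr (- \<beta> + real n)
        = poly \<phi> t ^ n * ((1 - t) powr (- \<alpha>) * (1 + t) powr (- \<beta>))"
      using t by (simp add: \<phi> powr_add powr_realpow power_mult_distrib del: add_uminus_conv_diff uminus_add_conv_diff)
    show "(-1) ^ n / (2 ^ n * fact n) * (1 - t) powr \<alpha> * (1 + t) powr \<beta>
        = (-1) ^ n / (2 ^ n * fact n) / ((1 - t) powr (- \<alpha>) * (1 + t) powr (- \<beta>))"
      using t by (simp add: powr_minus field_simps)
  next
    show "inv_jacobi_op \<alpha> \<beta> f x = poly \<phi> x * (deriv ^^ 2) f x + poly \<psi> x * deriv f x" for f x
      by (simp add: inv_jacobi_op_def \<phi> \<psi>_def power2_eq_square algebra_simps)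
  qed (use assms in auto)
qed

theorem theorem1p5:
  fixes I :: "real set"
    and D :: "(real \<Rightarrow> real) \<Rightarrow> real \<Rightarrow> real"
    and P Q :: "nat \<Rightarrow> real poly"
    and lambda1 :: real
  assumes family:
    "(I = UNIV \<and> P = inv_hermite \<and> D = inv_hermite_op) \<or>
     (\<exists>\<alpha>>-1. \<alpha> \<notin> real ` {1..} \<and>
        I = {0<..} \<and> P = inv_laguerre \<alpha> \<and> D = inv_laguerre_op \<alpha>) \<or>
     (\<exists>\<alpha>>-1. \<exists>\<beta>>-1. \<alpha> \<notin> real ` {1..} \<and> \<beta> \<notin> real ` {1..} \<and> \<alpha> + \<beta> \<notin> real ` {2..} \<and>
        I = {-1<..<1} \<and> P = inv_jacobi \<alpha> \<beta> \<and> D = inv_jacobi_op \<alpha> \<beta>)"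
    and monic: "Q = monic_version P"
    and first_eigenvalue: "lambda1 = eigenvalue I D Q 1"
  shows "\<exists>!L. moment_functional L \<and> L 1 = lambda1 \<and>
           (\<forall>m n. m \<noteq> n \<longrightarrow> L (Q m * Q n) = 0) \<and>
           (\<forall>n. L ((Q n)\<^sup>2) \<noteq> 0)"
  using family
proof (elim disjE exE conjE)
  assume "I = UNIV" "P = inv_hermite" "D = inv_hermite_op"
  then show ?thesis
    using monic first_eigenvalue by (intro inv_hermite_unique_functional) simp_all
next
  fix \<alpha> :: real
  assume "\<alpha> \<notin> real ` {1..}" "I = {0<..}" "P = inv_laguerre \<alpha>" "D = inv_laguerre_op \<alpha>"
  then show ?thesis
    using monic first_eigenvalue by (intro inv_laguerre_unique_functional[of \<alpha>]) simp_all
next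
  fix \<alpha> \<beta> :: real
  assume "\<alpha> \<notin> real ` {1..}" "\<beta> \<notin> real ` {1..}" "\<alpha> + \<beta> \<notin> real ` {2..}"
    "I = {-1<..<1}" "P = inv_jacobi \<alpha> \<beta>" "D = inv_jacobi_op \<alpha> \<beta>"
  then show ?thesis
    using monic first_eigenvalue by (intro inv_jacobi_unique_functional[of \<alpha> \<beta>]) simp_all
qed

end
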